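(* Let $d\in\mathbb N$ and let $(c_n)_{n\ge 1}$ be a sequence of positive real numbers such that for every permutation $(c'_n)$ of $(c_n)$ the sequence $(\sqrt[d]{n}/c'_n)_{n\ge1}$ is unbounded. Then there exists a continuous, nonnegative function $f:\mathbb R^d\to\mathbb R$ such that $\int_{\mathbb R^d}|f(x)|\,dx<\infty$ and $\sum_{n=1}^\infty|f(c_nx)|=\infty$ for every $x\in\mathbb R^d$.
   Context: $\mathbb N=\{1,2,3,\dots\}$; integration is with respect to the $d$-dimensional Lebesgue measure. A permutation of a sequence $(c_n)_{n\ge1}$ is a sequence $(c'_n)_{n\ge1}$ of the form $c'_n=c_{\sigma(n)}$ for a bijection $\sigma:\mathbb N\to\mathbb N$. *)

theory Defs
  imports "HOL-Analysis.Analysis"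
begin

end

theory Submission
  imports Defs
begin

text \<open>
  Write \<open>N r\<close> for the number of indices \<open>n\<close> with \<open>c n \<le> r\<close>, and let \<open>d\<close> be the dimension.

  If \<open>N r \<le> K * r ^ d\<close> held for all \<open>r \<ge> 1\<close>, then every sublevel set would be finite, so the
  sequence could be listed in increasing order.  The term \<open>r\<close> in position \<open>n\<close> then satisfies
  \<open>n \<le> N r \<le> K * r ^ d\<close> as soon as \<open>r \<ge> 1\<close>, so this rearrangement keeps
  \<open>root d n / r\<close> bounded.  Hence the hypothesis on permutations forces \<open>N r / r ^ d\<close> to be unbounded
  on \<open>r \<ge> 1\<close>, where \<open>N r\<close> may be infinite (\<open>exists_dense_sublevel\<close>).

  Thus there are radii \<open>r k \<ge> 1\<close> with \<open>N (r k) \<ge> 4 ^ k * b k ^ d\<close>, where \<open>b k = (k + 1) * r k\<close>.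
  Let \<open>f\<close> be the sum over \<open>k\<close> of plateau functions that equal \<open>h k = 1 / (2 ^ k * b k ^ d)\<close> on the ball
  of radius \<open>b k\<close> and vanish outside the ball of radius \<open>2 * b k\<close>.  The \<open>k\<close>-th plateau has integral at
  most \<open>2 ^ d / 2 ^ k\<close> times the volume of the unit ball, so \<open>f\<close> is integrable.  As \<open>b k \<ge> 1\<close>, the
  heights satisfy \<open>h k \<le> 1 / 2 ^ k\<close>, so the series converges uniformly and \<open>f\<close> is continuous.  If
  \<open>norm x \<le> k + 1\<close> and \<open>c n \<le> r k\<close>, then \<open>c n * x\<close> lies in the ball of radius \<open>b k\<close>; these \<open>n\<close> alone
  contribute at least \<open>N (r k) * h k \<ge> 2 ^ k\<close> to the sum of the \<open>f (c n * x)\<close>.  Since \<open>k\<close> is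
  arbitrarily large, the sum diverges for every \<open>x\<close>.
\<close>

section \<open>Sorting a sequence with finite sublevel sets\<close>

text \<open>
  The position of an index in the increasing rearrangement, with ties broken by the index itself.
  This rank is the inverse of the sorting permutation: its range has no gaps because deleting the
  largest element of an initial segment leaves an initial segment.
\<close>

lemma rank_bij_betw:
  fixes f :: "'a::linorder \<Rightarrow> 'b::linorder"
  assumes inf: "infinite A"
    and fin: "\<And>m. m \<in> A \<Longrightarrow> finite {j\<in>A. f j \<le> f m}"
  shows "bij_betw (\<lambda>m. card {j\<in>A. f j < f m \<or> f j = f m \<and> j \<le> m}) A {1..}"
proof -
  define P where "P m = {j\<in>A. f j < f m \<or> f j = f m \<and> j \<le> m}" for m
  have finP: "finite (P m)" if "m \<in> A" for m
    by (rule finite_subset[OF _ fin[OF that]]) (auto simp: P_def)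
  have self: "m \<in> P m" if "m \<in> A" for m
    using that by (auto simp: P_def)
  have psub: "P j \<subset> P m" if "j \<in> P m" "j \<noteq> m" "m \<in> A" for j m
    using that by (fastforce simp: P_def)
  have comparable: "j \<in> P m \<or> m \<in> P j" if "j \<in> A" "m \<in> A" for j m
    using that by (auto simp: P_def)
  have inj: "inj_on (\<lambda>m. card (P m)) A"
  proof (rule inj_onI, rule ccontr)
    fix x y assume "x \<in> A" "y \<in> A" "card (P x) = card (P y)" "x \<noteq> y"
    then show False
      using comparable[of x y] psub psubset_card_mono[OF finP] by (metis less_irrefl)
  qed
  have pred: "\<exists>m'\<in>A. card (P m') = k" if "m \<in> A" "card (P m) = Suc k" "k \<ge> 1" for m k
  proof -
    define Q where "Q = P m - {m}"
    have finQ: "finite Q" and cardQ: "card Q = k"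
      using that self[of m] finP[of m] by (auto simp: Q_def)
    then have "Q \<noteq> {}" using that by auto
    then have "Max ((\<lambda>j. card (P j)) ` Q) \<in> (\<lambda>j. card (P j)) ` Q"
      using finQ by (intro Max_in) auto
    then obtain q where q: "q \<in> Q" "card (P q) = Max ((\<lambda>j. card (P j)) ` Q)"
      by force
    have qmax: "card (P j) \<le> card (P q)" if "j \<in> Q" for j
      using that finQ q(2) by simp
    have QA: "Q \<subseteq> A" by (auto simp: Q_def P_def)
    have "P q = Q"
    proof
      show "P q \<subseteq> Q"
        using q(1) \<open>m \<in> A\<close> by (fastforce simp: Q_def P_def)
      show "Q \<subseteq> P q"
      proof (rule ccontr)
        assume "\<not> Q \<subseteq> P q"
        then obtain j where j: "j \<in> Q" "j \<notin> P q" by auto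
        then have "P q \<subset> P j"
          using comparable[of j q] psub[of q j] self[of q] QA q(1) by blast
        then have "card (P q) < card (P j)"
          using psubset_card_mono[OF finP] j QA by blast
        then show False using qmax[OF j(1)] by simp
      qed
    qed
    then show ?thesis using q QA cardQ by auto
  qed
  let ?R = "(\<lambda>m. card (P m)) ` A"
  have down: "k \<in> ?R" if "n \<in> ?R" "1 \<le> k" "k \<le> n" for k n
    using \<open>k \<le> n\<close>
  proof (induction rule: inc_induct)
    case base
    show ?case by (rule \<open>n \<in> ?R\<close>)
  next
    case (step i)
    then obtain m where "m \<in> A" "card (P m) = Suc i" by auto
    then show ?case using pred[of m i] step.hyps \<open>1 \<le> k\<close> by auto
  qed
  have "infinite ?R" using inf inj by (simp add: finite_image_iff)
  then have "{1..} \<subseteq> ?R"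
    using down by (metis atLeast_iff infinite_nat_iff_unbounded_le subsetI)
  moreover have "?R \<subseteq> {1..}"
    using self finP by (fastforce simp: Suc_le_eq card_gt_0_iff)
  ultimately show ?thesis
    using inj unfolding bij_betw_def P_def by blast
qed

section \<open>Dense sublevel sets\<close>

text \<open>
  If every sublevel set for a radius \<open>r \<ge> 1\<close> had fewer than \<open>K * r ^ d\<close> elements, the increasing
  rearrangement would have bounded quotients.  Restricting to \<open>r \<ge> 1\<close> costs nothing: terms that are at
  most \<open>1\<close> occupy finitely many positions of the sorted sequence, and finitely many quotients are
  always bounded.  The sets \<open>F\<close> are finite subsets of sublevel sets because a sublevel set may itself
  be infinite, and its \<open>card\<close> would then be \<open>0\<close>.
\<close>

lemma exists_dense_sublevel:
  fixes c :: "nat \<Rightarrow> real"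
  assumes d: "d > 0"
    and unbounded: "\<And>\<sigma>. bij_betw \<sigma> {1..} {1..} \<Longrightarrow>
      \<not> bounded ((\<lambda>n::nat. root d (real n) / c (\<sigma> n)) ` {1..})"
  shows "\<exists>r\<ge>1. \<exists>F. finite F \<and> F \<subseteq> {1..} \<and> (\<forall>n\<in>F. c n \<le> r) \<and> K * r ^ d \<le> real (card F)"
proof (rule ccontr)
  assume contr: "\<not> ?thesis"
  have small: "real (card F) < K * r ^ d"
    if "r \<ge> 1" "finite F" "F \<subseteq> {1..}" "\<forall>n\<in>F. c n \<le> r" for r F
    using contr that by (meson not_le)
  \<comment> \<open>The bound on finite subsets already rules out infinite sublevel sets.\<close>
  have fin: "finite {j\<in>{1..}. c j \<le> r}" for r
  proof (rule finite_if_finite_subsets_card_bdd[where C = "nat \<lceil>K * max 1 r ^ d\<rceil>", THEN conjunct1])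
    fix G assume "G \<subseteq> {j\<in>{1..}. c j \<le> r}" "finite G"
    then have "real (card G) < K * max 1 r ^ d"
      by (intro small) auto
    then show "card G \<le> nat \<lceil>K * max 1 r ^ d\<rceil>" by linarith
  qed
  define \<rho> where "\<rho> m = card {j\<in>{1::nat..}. c j < c m \<or> c j = c m \<and> j \<le> m}" for m
  have bij: "bij_betw \<rho> {1..} {1..}"
    unfolding \<rho>_def by (rule rank_bij_betw[OF infinite_Ici fin])
  define \<sigma> where "\<sigma> = inv_into {1..} \<rho>"
  have bij\<sigma>: "bij_betw \<sigma> {1..} {1..}"
    unfolding \<sigma>_def by (rule bij_betw_inv_into[OF bij])
  have bound: "real n < K * max 1 (c (\<sigma> n)) ^ d" if "n \<ge> 1" for n
  proof -
    have "n = \<rho> (\<sigma> n)"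
      using bij_betw_inv_into_right[OF bij, of n] that by (simp add: \<sigma>_def)
    also have "\<dots> \<le> card {j\<in>{1..}. c j \<le> c (\<sigma> n)}"
      unfolding \<rho>_def by (intro card_mono fin) auto
    finally have "real n \<le> real (card {j\<in>{1..}. c j \<le> c (\<sigma> n)})"
      by simp
    also have "\<dots> < K * max 1 (c (\<sigma> n)) ^ d"
      by (intro small fin) auto
    finally show ?thesis .
  qed
  let ?q = "\<lambda>n. root d (real n) / c (\<sigma> n)"
  have "?q n \<in> ?q ` {..nat \<lceil>K\<rceil>} \<union> {0..root d K}" if n: "n \<ge> 1" for n
  proof (cases "c (\<sigma> n) \<le> 1")
    case True
    then have "real n < K" using bound[OF n] by (simp add: max_def split: if_splits)
    then have "n \<le> nat \<lceil>K\<rceil>" by linarith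
    then show ?thesis by blast
  next
    case False
    then have "root d (real n) \<le> root d (K * c (\<sigma> n) ^ d)"
      using bound[OF n] d by (simp add: max_def)
    also have "\<dots> = root d K * c (\<sigma> n)"
      using False d by (simp add: real_root_mult real_root_power_cancel)
    finally have "?q n \<le> root d K" using False by (simp add: divide_le_eq)
    moreover have "0 \<le> ?q n" using False d by simp
    ultimately show ?thesis by simp
  qed
  then have "?q ` {1..} \<subseteq> ?q ` {..nat \<lceil>K\<rceil>} \<union> {0..root d K}"
    by (intro image_subsetI) simp
  moreover have "bounded (?q ` {..nat \<lceil>K\<rceil>} \<union> {0..root d K})"
    unfolding bounded_Un using finite_imp_bounded[of "?q ` {..nat \<lceil>K\<rceil>}"] by simp
  ultimately show False
    using unbounded[OF bij\<sigma>] bounded_subset by blast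
qed

section \<open>Sums of plateau functions\<close>

definition plateau :: "real \<Rightarrow> 'a::real_normed_vector \<Rightarrow> real" where
  "plateau b x = max 0 (min 1 (2 - norm x / b))"

lemma plateau_nonneg: "plateau b x \<ge> 0"
  and plateau_le_1: "plateau b x \<le> 1"
  by (auto simp: plateau_def)

lemma plateau_eq_1: "plateau b x = 1" if "b > 0" "norm x \<le> b"
  using that by (simp add: plateau_def field_simps)

lemma continuous_on_plateau: "continuous_on S (plateau b)"
  unfolding plateau_def divide_inverse by (intro continuous_intros)

lemma plateau_le_indicator: "plateau b x \<le> indicator (cball 0 (2 * b)) x" if "b > 0"
  using that by (auto simp: plateau_def indicator_def field_simps)

lemma nn_integral_plateau_le:
  fixes b :: real
  assumes "b > 0"
  shows "(\<integral>\<^sup>+x. ennreal (plateau b (x::'a::euclidean_space)) \<partial>lborel)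
    \<le> ennreal (unit_ball_vol DIM('a) * (2 * b) ^ DIM('a))"
proof -
  have "(\<integral>\<^sup>+x. ennreal (plateau b (x::'a)) \<partial>lborel)
      \<le> (\<integral>\<^sup>+x. indicator (cball 0 (2 * b)) (x::'a) \<partial>lborel)"
    by (intro nn_integral_mono)
      (metis assms ennreal_indicator ennreal_leI plateau_le_indicator)
  also have "\<dots> = emeasure lborel (cball (0::'a) (2 * b))"
    by simp
  also have "\<dots> = ennreal (unit_ball_vol DIM('a) * (2 * b) ^ DIM('a))"
    using assms by (subst emeasure_cball) (auto simp: mult.commute)
  finally show ?thesis .
qed

text \<open>
  The two summability conditions do different work: summable heights give uniform convergence, hence
  continuity, while summable volumes \<open>h k * b k ^ DIM('a)\<close> give a finite integral.
\<close>

lemma plateau_series: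
  fixes h b :: "nat \<Rightarrow> real"
  assumes h: "\<And>k. h k \<ge> 0" "summable h"
    and b: "\<And>k. b k > 0"
    and vol: "summable (\<lambda>k. h k * b k ^ DIM('a::euclidean_space))"
  defines "f \<equiv> \<lambda>x::'a. \<Sum>k. h k * plateau (b k) x"
  shows "continuous_on UNIV f"
    and "\<And>k x. h k * plateau (b k) x \<le> f x"
    and "(\<integral>\<^sup>+x. ennreal (f x) \<partial>lborel) < \<infinity>"
proof -
  have term0: "0 \<le> h k * plateau (b k) x" for k and x :: 'a
    by (intro mult_nonneg_nonneg h(1) plateau_nonneg)
  have term_le: "h k * plateau (b k) x \<le> h k" for k and x :: 'a
    by (intro mult_left_le h(1) plateau_le_1)
  have summ: "summable (\<lambda>k. h k * plateau (b k) x)" for x :: 'a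
    by (rule summable_comparison_test'[OF h(2), of 0]) (use term0 term_le in auto)
  have "uniform_limit UNIV (\<lambda>n x. \<Sum>k<n. h k * plateau (b k) x) f sequentially"
    unfolding f_def
    by (rule Weierstrass_m_test[OF _ h(2)]) (use term0 term_le in auto)
  then show "continuous_on UNIV f"
    by (rule uniform_limit_theorem[rotated])
      (auto intro!: always_eventually continuous_intros continuous_on_plateau)
  show "h k * plateau (b k) x \<le> f x" for k x
    using sum_le_suminf[OF summ, of "{k}" x] term0 by (simp add: f_def)
  have meas: "(\<lambda>x::'a. ennreal (h k * plateau (b k) x)) \<in> borel_measurable lborel" for k
    by (intro measurable_compose[OF _ measurable_ennreal] borel_measurable_times
        borel_measurable_const)
      (simp add: borel_measurable_continuous_onI continuous_on_plateau)
  have measp: "(\<lambda>x::'a. ennreal (plateau (b k) x)) \<in> borel_measurable lborel" for k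
    by (intro measurable_compose[OF _ measurable_ennreal])
      (simp add: borel_measurable_continuous_onI continuous_on_plateau)
  define C where "C = unit_ball_vol (real DIM('a)) * 2 ^ DIM('a)"
  have C0: "C \<ge> 0" by (simp add: C_def)
  have "(\<integral>\<^sup>+x. ennreal (f x) \<partial>lborel)
      = (\<integral>\<^sup>+x. (\<Sum>k. ennreal (h k * plateau (b k) (x::'a))) \<partial>lborel)"
    unfolding f_def by (intro nn_integral_cong suminf_ennreal2[symmetric] term0 summ)
  also have "\<dots> = (\<Sum>k. \<integral>\<^sup>+x. ennreal (h k * plateau (b k) (x::'a)) \<partial>lborel)"
    by (rule nn_integral_suminf[OF meas])
  also have "\<dots> \<le> (\<Sum>k. ennreal (C * (h k * b k ^ DIM('a))))"
  proof (intro suminf_le summableI)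
    fix k
    have "(\<integral>\<^sup>+x. ennreal (h k * plateau (b k) (x::'a)) \<partial>lborel)
        = ennreal (h k) * (\<integral>\<^sup>+x. ennreal (plateau (b k) (x::'a)) \<partial>lborel)"
      using measp by (simp add: ennreal_mult h(1) plateau_nonneg nn_integral_cmult)
    also have "\<dots> \<le> ennreal (h k) * ennreal (unit_ball_vol DIM('a) * (2 * b k) ^ DIM('a))"
      by (intro mult_left_mono nn_integral_plateau_le b) simp
    also have "\<dots> = ennreal (C * (h k * b k ^ DIM('a)))"
      using h(1)[of k] b[of k]
      by (simp add: C_def power_mult_distrib mult_ac flip: ennreal_mult)
    finally show "(\<integral>\<^sup>+x. ennreal (h k * plateau (b k) (x::'a)) \<partial>lborel)
        \<le> ennreal (C * (h k * b k ^ DIM('a)))" .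
  qed
  also have "\<dots> = ennreal (\<Sum>k. C * (h k * b k ^ DIM('a)))"
    using C0 h(1) b by (intro suminf_ennreal2 summable_mult vol) (simp add: less_imp_le)
  also have "\<dots> < \<infinity>" by simp
  finally show "(\<integral>\<^sup>+x. ennreal (f x) \<partial>lborel) < \<infinity>" .
qed

section \<open>Divergence at every point\<close>

theorem theorem3:
  fixes c :: "nat \<Rightarrow> real"
  assumes pos: "\<And>n. n \<ge> 1 \<Longrightarrow> c n > 0"
    and unbounded: "\<And>\<sigma>. bij_betw \<sigma> {1..} {1..} \<Longrightarrow>
      \<not> bounded ((\<lambda>n::nat. root CARD('d::finite) (real n) / c (\<sigma> n)) ` {1..})"
  shows "\<exists>f :: real ^ 'd \<Rightarrow> real.
    continuous_on UNIV f \<and> (\<forall>x. f x \<ge> 0) \<and>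
    (\<integral>\<^sup>+x. ennreal \<bar>f x\<bar> \<partial>lborel) < \<infinity> \<and>
    (\<forall>x. (\<Sum>n. ennreal \<bar>f (c (Suc n) *\<^sub>R x)\<bar>) = \<infinity>)"
proof -
  let ?d = "CARD('d)"
  \<comment> \<open>The factor \<open>4 ^ k * (k + 1) ^ d\<close> pays for the ball of radius \<open>(k + 1) * r k\<close>, the decay
    \<open>1 / 2 ^ k\<close> of the volumes, and a surplus of \<open>2 ^ k\<close>.\<close>
  have "\<forall>k. \<exists>r F. r \<ge> 1 \<and> finite F \<and> F \<subseteq> {1..} \<and> (\<forall>n\<in>F. c n \<le> r) \<and>
      4 ^ k * real (k + 1) ^ ?d * r ^ ?d \<le> real (card F)"
    using exists_dense_sublevel[of ?d c, OF zero_less_card_finite unbounded] by meson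
  then obtain r F where r: "\<And>k. r k \<ge> 1"
    and F: "\<And>k. finite (F k)" "\<And>k. F k \<subseteq> {1..}" "\<And>k n. n \<in> F k \<Longrightarrow> c n \<le> r k"
    and card: "\<And>k. 4 ^ k * real (k + 1) ^ ?d * r k ^ ?d \<le> real (card (F k))"
    by metis
  define b where "b k = real (k + 1) * r k" for k
  define h where "h k = (1 / 2) ^ k / b k ^ ?d" for k
  have b1: "b k \<ge> 1" for k
    using mult_mono[of 1 "real (k + 1)" 1 "r k"] r[of k] by (simp add: b_def)
  then have b0: "b k > 0" for k using less_le_trans zero_less_one by blast
  have h0: "h k \<ge> 0" for k using b0[of k] by (simp add: h_def)
  have hb: "h k * b k ^ ?d = (1 / 2) ^ k" for k
    using b0[of k] by (simp add: h_def)
  have "h k \<le> (1 / 2) ^ k" for k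
    unfolding h_def using one_le_power[OF b1[of k], of ?d] by (simp add: field_simps)
  then have hsum: "summable h"
    using h0 by (intro summable_comparison_test'[OF summable_geometric[of "1/2::real"], of 0]) auto
  have heavy: "2 ^ k \<le> real (card (F k)) * h k" for k
  proof -
    have "2 ^ k = 4 ^ k * (h k * b k ^ ?d)"
      by (simp add: hb flip: power_mult_distrib)
    also have "\<dots> = (4 ^ k * real (k + 1) ^ ?d * r k ^ ?d) * h k"
      by (simp only: b_def power_mult_distrib mult_ac)
    also have "\<dots> \<le> real (card (F k)) * h k"
      by (intro mult_right_mono card h0)
    finally show ?thesis .
  qed
  define f :: "real ^ 'd \<Rightarrow> real" where "f x = (\<Sum>k. h k * plateau (b k) x)" for x
  have vol: "summable (\<lambda>k. h k * b k ^ DIM(real ^ 'd))"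
    by (simp add: hb summable_geometric)
  note series = plateau_series[OF h0 hsum b0 vol, folded f_def]
  have f0: "f x \<ge> 0" for x
    using series(2)[of 0 x] h0[of 0] plateau_nonneg[of "b 0" x]
    by (meson mult_nonneg_nonneg order_trans)
  have large: "ennreal (2 ^ k) \<le> (\<Sum>n. ennreal \<bar>f (c (Suc n) *\<^sub>R x)\<bar>)"
    if "norm x \<le> real (k + 1)" for k x
  proof -
    have ge: "h k \<le> f (c n *\<^sub>R x)" if n: "n \<in> F k" for n
    proof -
      have "c n > 0" using F(2)[of k] n by (intro pos) auto
      then have "norm (c n *\<^sub>R x) \<le> b k"
        using mult_mono[OF \<open>norm x \<le> real (k + 1)\<close> F(3)[OF n]]
        by (simp add: b_def mult.commute)
      then show ?thesis
        using series(2)[of k "c n *\<^sub>R x"] plateau_eq_1[OF b0 \<open>norm (c n *\<^sub>R x) \<le> b k\<close>]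
        by simp
    qed
    have "ennreal (2 ^ k) \<le> ennreal (\<Sum>n\<in>F k. h k)"
      using heavy[of k] by (intro ennreal_leI) simp
    also have "\<dots> \<le> ennreal (\<Sum>n\<in>F k. \<bar>f (c n *\<^sub>R x)\<bar>)"
      by (intro ennreal_leI sum_mono order_trans[OF ge abs_ge_self])
    also have "\<dots> = (\<Sum>n\<in>F k. ennreal \<bar>f (c n *\<^sub>R x)\<bar>)"
      by (simp add: sum_ennreal)
    \<comment> \<open>The series runs over \<open>Suc n\<close>, so the indices in \<open>F k\<close> are shifted down by one.\<close>
    also have "\<dots> = (\<Sum>n\<in>(\<lambda>n. n - 1) ` F k. ennreal \<bar>f (c (Suc n) *\<^sub>R x)\<bar>)"
    proof -
      have "inj_on (\<lambda>n. n - 1) (F k)"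
        using F(2)[of k] by (intro inj_on_diff_nat) auto
      then show ?thesis
        using F(2)[of k] by (subst sum.reindex) (auto intro!: sum.cong)
    qed
    also have "\<dots> \<le> (\<Sum>n. ennreal \<bar>f (c (Suc n) *\<^sub>R x)\<bar>)"
      by (intro sum_le_suminf summableI) (auto simp: F(1))
    finally show ?thesis .
  qed
  have "(\<Sum>n. ennreal \<bar>f (c (Suc n) *\<^sub>R x)\<bar>) = \<infinity>" for x
  proof (rule ccontr)
    assume "\<not> ?thesis"
    then obtain s where s: "s \<ge> 0" "(\<Sum>n. ennreal \<bar>f (c (Suc n) *\<^sub>R x)\<bar>) = ennreal s"
      by (metis ennreal_cases infinity_ennreal_def)
    obtain k where k: "max (norm x) s < real k"
      using reals_Archimedean2 by blast
    then have "ennreal (2 ^ k) \<le> ennreal s"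
      using large[of x k] s by simp
    then have "(2::real) ^ k \<le> s" using s by simp
    moreover have "real k < 2 ^ k" by (rule of_nat_less_two_power)
    ultimately show False using k by linarith
  qed
  moreover have "(\<integral>\<^sup>+x. ennreal \<bar>f x\<bar> \<partial>lborel) < \<infinity>"
    using series(3) f0 by simp
  ultimately show ?thesis using series(1) f0 by blast
qed

end
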